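(* Let $\mathbb{H}_1,\mathbb{H}_2$ be Hilbert spaces over the same field (real or complex) and let $T\in\mathbb{L}(\mathbb{H}_1,\mathbb{H}_2)$. If $m_T$ is non-empty, then $m_T$ is the unit sphere of some linear subspace of $\mathbb{H}_1$.
   Context: $\mathbb{L}(\mathbb{H}_1,\mathbb{H}_2)$ is the space of bounded linear operators from $\mathbb{H}_1$ to $\mathbb{H}_2$. $m(T)=\inf\{\|Tx\|:\|x\|=1\}$ and $m_T=\{x\in\mathbb{H}_1:\|x\|=1,\ \|Tx\|=m(T)\}$. The unit sphere of a subspace $V$ is $\{x\in V:\|x\|=1\}$. *)

theory Defs
  imports "HOL-Analysis.Analysis"
begin

text \<open>Real Hilbert spaces are the types of sort \<open>{real_inner, complete_space}\<close>. The distribution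
  has no complex inner product spaces. They are introduced here on the pattern of the real ones,
  so that complex Hilbert spaces are the types of sort \<open>{complex_inner, complete_space}\<close>.\<close>

class scaleC = scaleR +
  fixes scaleC :: "complex \<Rightarrow> 'a \<Rightarrow> 'a" (infixr \<open>*\<^sub>C\<close> 75)
  assumes scaleR_scaleC: "scaleR r = scaleC (complex_of_real r)"

class complex_vector = scaleC + ab_group_add +
  assumes scaleC_add_right: "a *\<^sub>C (x + y) = a *\<^sub>C x + a *\<^sub>C y"
    and scaleC_add_left: "(a + b) *\<^sub>C x = a *\<^sub>C x + b *\<^sub>C x"
    and scaleC_scaleC: "a *\<^sub>C b *\<^sub>C x = (a * b) *\<^sub>C x"
    and scaleC_one: "1 *\<^sub>C x = x"

subclass (in complex_vector) real_vector
  by standard (simp_all add: scaleR_scaleC scaleC_add_right scaleC_add_left scaleC_scaleC scaleC_one)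

text \<open>The inner product is linear in the first argument. Its value at \<open>(x, x)\<close> is real by
  \<open>cinner_commute\<close>, so only its real part occurs in the last two axioms. The class
  \<open>real_normed_vector\<close> provides the metric and the topology of the norm; the norm
  axioms it contains follow from those of the inner product.\<close>

class complex_inner = complex_vector + real_normed_vector +
  fixes cinner :: "'a \<Rightarrow> 'a \<Rightarrow> complex"
  assumes cinner_commute: "cinner x y = cnj (cinner y x)"
    and cinner_add_left: "cinner (x + y) z = cinner x z + cinner y z"
    and cinner_scaleC_left: "cinner (a *\<^sub>C x) y = a * cinner x y"
    and cinner_eq_zero_iff: "cinner x x = 0 \<longleftrightarrow> x = 0"
    and cinner_ge_zero: "0 \<le> Re (cinner x x)"
    and norm_eq_sqrt_cinner: "norm x = sqrt (Re (cinner x x))"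

global_interpretation complex_vector: vector_space "scaleC :: complex \<Rightarrow> 'a \<Rightarrow> 'a::complex_vector"
  defines csubspace = complex_vector.subspace
  by standard (simp_all add: scaleC_add_right scaleC_add_left scaleC_scaleC scaleC_one)

definition bounded_clinear :: "('a::complex_inner \<Rightarrow> 'b::complex_inner) \<Rightarrow> bool"
  where "bounded_clinear T \<longleftrightarrow>
    Vector_Spaces.linear scaleC scaleC T \<and> (\<exists>K. \<forall>x. norm (T x) \<le> norm x * K)"

definition min_modulus :: "('a::real_normed_vector \<Rightarrow> 'b::real_normed_vector) \<Rightarrow> real"
  where "min_modulus T = Inf {norm (T x) |x. norm x = 1}"

definition min_attainment_set :: "('a::real_normed_vector \<Rightarrow> 'b::real_normed_vector) \<Rightarrow> 'a set"
  where "min_attainment_set T = {x. norm x = 1 \<and> norm (T x) = min_modulus T}"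

end

theory Submission
  imports Defs
begin

text \<open>Put \<open>m = m(T)\<close> and \<open>V = {x. \<parallel>T x\<parallel> = m \<parallel>x\<parallel>}\<close>, whose unit sphere is \<open>m\<^sub>T\<close>. Homogeneity makes
  \<open>V\<close> closed under scalars. For \<open>x, y \<in> V\<close> the parallelogram laws of both spaces give
  \<open>\<parallel>T (x + y)\<parallel>\<^sup>2 + \<parallel>T (x - y)\<parallel>\<^sup>2 = m\<^sup>2 (\<parallel>x + y\<parallel>\<^sup>2 + \<parallel>x - y\<parallel>\<^sup>2)\<close>; since \<open>\<parallel>T z\<parallel> \<ge> m \<parallel>z\<parallel>\<close> for every
  \<open>z\<close>, equality holds in each summand, so \<open>x + y \<in> V\<close>. Both scalar fields are covered by
  one argument that uses only the parallelogram law.\<close>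

definition min_scaling_set :: "('a::real_normed_vector \<Rightarrow> 'b::real_normed_vector) \<Rightarrow> 'a set"
  where "min_scaling_set T = {x. norm (T x) = min_modulus T * norm x}"

lemma min_attainment_set_eq_sphere:
  "min_attainment_set T = {x \<in> min_scaling_set T. norm x = 1}"
  by (auto simp: min_attainment_set_def min_scaling_set_def)

text \<open>An attaining vector exhibits \<open>min_modulus T\<close> as the value of a norm. On a
  zero space the set under \<open>Inf\<close> is empty and its infimum unspecified, so some such
  witness is called for.\<close>

lemma min_modulus_nonneg:
  assumes "min_attainment_set T \<noteq> {}"
  shows "0 \<le> min_modulus T"
  using assms by (force simp: min_attainment_set_def dest: sym)

lemma min_modulus_le:
  assumes "norm x = 1"
  shows "min_modulus T \<le> norm (T x)"
proof -
  have "bdd_below {norm (T x) |x. norm x = 1}"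
    by (rule bdd_belowI[where m = 0]) auto
  then show ?thesis
    unfolding min_modulus_def using assms by (intro cInf_lower) auto
qed

lemma min_modulus_mult_norm_le:
  assumes "linear T"
  shows "min_modulus T * norm x \<le> norm (T x)"
proof (cases "x = 0")
  case False
  \<comment> \<open>Normalising \<open>x\<close> reduces the claim to the unit sphere.\<close>
  then have "min_modulus T \<le> norm (T (x /\<^sub>R norm x))"
    by (intro min_modulus_le) simp
  also have "\<dots> = norm (T x) / norm x"
    by (simp add: linear_scale[OF assms] divide_inverse_commute)
  finally show ?thesis
    using False by (simp add: field_simps)
qed simp

text \<open>The parallelogram laws enter as hypotheses because \<open>complex_inner\<close> is not a
  subclass of \<open>real_inner\<close>; over \<open>real_normed_vector\<close> one statement serves
  both.\<close>

lemma min_scaling_set_add: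
  fixes T :: "'a::real_normed_vector \<Rightarrow> 'b::real_normed_vector"
  assumes "linear T" and nonneg: "0 \<le> min_modulus T"
    and parallelogram_dom: "\<And>x y::'a. (norm (x + y))\<^sup>2 + (norm (x - y))\<^sup>2 = 2 * (norm x)\<^sup>2 + 2 * (norm y)\<^sup>2"
    and parallelogram_cod: "\<And>x y::'b. (norm (x + y))\<^sup>2 + (norm (x - y))\<^sup>2 = 2 * (norm x)\<^sup>2 + 2 * (norm y)\<^sup>2"
    and "x \<in> min_scaling_set T" "y \<in> min_scaling_set T"
  shows "x + y \<in> min_scaling_set T"
proof -
  let ?m = "min_modulus T"
  \<comment> \<open>Squaring preserves the lower bound because \<open>?m\<close> is
    nonnegative.\<close>
  have lower: "(?m * norm z)\<^sup>2 \<le> (norm (T z))\<^sup>2" for z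
    using min_modulus_mult_norm_le[OF \<open>linear T\<close>] nonneg by (intro power_mono) auto
  have "(norm (T (x + y)))\<^sup>2 + (norm (T (x - y)))\<^sup>2 = 2 * (norm (T x))\<^sup>2 + 2 * (norm (T y))\<^sup>2"
    using parallelogram_cod by (simp add: linear_add[OF \<open>linear T\<close>] linear_diff[OF \<open>linear T\<close>])
  also have "\<dots> = ?m\<^sup>2 * (2 * (norm x)\<^sup>2 + 2 * (norm y)\<^sup>2)"
    using assms(5,6) by (simp add: min_scaling_set_def power_mult_distrib algebra_simps)
  also have "\<dots> = (?m * norm (x + y))\<^sup>2 + (?m * norm (x - y))\<^sup>2"
    by (simp only: parallelogram_dom[symmetric] power_mult_distrib distrib_left)
  finally have "(norm (T (x + y)))\<^sup>2 = (?m * norm (x + y))\<^sup>2"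
    using lower[of "x + y"] lower[of "x - y"] by linarith
  then show ?thesis
    using nonneg by (simp add: min_scaling_set_def power2_eq_iff_nonneg)
qed

lemma parallelogram_real:
  fixes x y :: "'a::real_inner"
  shows "(norm (x + y))\<^sup>2 + (norm (x - y))\<^sup>2 = 2 * (norm x)\<^sup>2 + 2 * (norm y)\<^sup>2"
  by (simp add: power2_norm_eq_inner inner_add_left inner_add_right inner_diff_left inner_diff_right)

lemma subspace_min_scaling_set:
  fixes T :: "'a::real_inner \<Rightarrow> 'b::real_inner"
  assumes "linear T" "0 \<le> min_modulus T"
  shows "subspace (min_scaling_set T)"
  unfolding subspace_def
proof (intro conjI allI ballI)
  show "0 \<in> min_scaling_set T"
    by (simp add: min_scaling_set_def linear_0[OF \<open>linear T\<close>])
  show "x + y \<in> min_scaling_set T" if "x \<in> min_scaling_set T" "y \<in> min_scaling_set T" for x y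
    using min_scaling_set_add[OF assms parallelogram_real parallelogram_real that] .
  show "c *\<^sub>R x \<in> min_scaling_set T" if "x \<in> min_scaling_set T" for c x
    using that by (simp add: min_scaling_set_def linear_scale[OF \<open>linear T\<close>])
qed

lemma power2_norm_eq_cinner: "(norm (x::'a::complex_inner))\<^sup>2 = Re (cinner x x)"
  by (simp add: norm_eq_sqrt_cinner cinner_ge_zero)

lemma cinner_add_right: "cinner (x::'a::complex_inner) (y + z) = cinner x y + cinner x z"
  by (metis cinner_add_left cinner_commute complex_cnj_add)

lemma cinner_scaleC_right: "cinner (x::'a::complex_inner) (c *\<^sub>C y) = cnj c * cinner x y"
  by (metis cinner_commute cinner_scaleC_left complex_cnj_mult)

lemma cinner_diff_left: "cinner (x - y) (z::'a::complex_inner) = cinner x z - cinner y z"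
  by (metis add_diff_cancel diff_add_cancel cinner_add_left)

lemma cinner_diff_right: "cinner (x::'a::complex_inner) (y - z) = cinner x y - cinner x z"
  by (metis add_diff_cancel diff_add_cancel cinner_add_right)

text \<open>\<open>real_normed_vector\<close> gives homogeneity for real scalars only; for complex
  ones it comes from the inner product, where \<open>c\<close> and \<open>cnj c\<close> combine to
  the square of \<open>cmod c\<close>.\<close>

lemma norm_scaleC: "norm (c *\<^sub>C (x::'a::complex_inner)) = cmod c * norm x"
proof -
  have "cinner (c *\<^sub>C x) (c *\<^sub>C x) = complex_of_real ((cmod c)\<^sup>2) * cinner x x"
    by (simp add: cinner_scaleC_left cinner_scaleC_right complex_norm_square mult_ac del: of_real_power)
  \<comment> \<open>The factor is real, so it passes through \<open>Re\<close>.\<close>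
  then have "(norm (c *\<^sub>C x))\<^sup>2 = (cmod c * norm x)\<^sup>2"
    by (simp only: power2_norm_eq_cinner power_mult_distrib Re_complex_of_real Im_complex_of_real
        times_complex.sel mult_zero_left diff_0_right)
  then show ?thesis
    by (simp add: power2_eq_iff_nonneg)
qed

text \<open>The mixed terms \<open>cinner x y\<close> and \<open>cinner y x\<close> occur with
  opposite signs in the two expansions and cancel.\<close>

lemma parallelogram_complex:
  fixes x y :: "'a::complex_inner"
  shows "(norm (x + y))\<^sup>2 + (norm (x - y))\<^sup>2 = 2 * (norm x)\<^sup>2 + 2 * (norm y)\<^sup>2"
  by (simp add: power2_norm_eq_cinner cinner_add_left cinner_add_right cinner_diff_left cinner_diff_right)

lemma csubspace_min_scaling_set:
  fixes T :: "'a::complex_inner \<Rightarrow> 'b::complex_inner"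
  assumes "Vector_Spaces.linear scaleC scaleC T" and nonneg: "0 \<le> min_modulus T"
  shows "csubspace (min_scaling_set T)"
proof -
  interpret T: Vector_Spaces.linear scaleC scaleC T
    by fact
  \<comment> \<open>Complex linearity restricts to real scalars, which makes the shared additivity
    lemma applicable.\<close>
  have lin: "linear T"
    by (rule linearI) (simp_all add: T.add T.scale scaleR_scaleC)
  show ?thesis
    unfolding complex_vector.subspace_def
  proof (intro conjI allI ballI)
    show "0 \<in> min_scaling_set T"
      by (simp add: min_scaling_set_def linear_0[OF lin])
    show "x + y \<in> min_scaling_set T" if "x \<in> min_scaling_set T" "y \<in> min_scaling_set T" for x y
      using min_scaling_set_add[OF lin nonneg parallelogram_complex parallelogram_complex that] .
    show "c *\<^sub>C x \<in> min_scaling_set T" if "x \<in> min_scaling_set T" for c x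
      using that by (simp add: min_scaling_set_def T.scale norm_scaleC)
  qed
qed

theorem mainTheorem9:
  fixes S :: "'a::{real_inner, complete_space} \<Rightarrow> 'b::{real_inner, complete_space}"
    and T :: "'c::{complex_inner, complete_space} \<Rightarrow> 'd::{complex_inner, complete_space}"
  shows "(bounded_linear S \<longrightarrow> min_attainment_set S \<noteq> {} \<longrightarrow>
      (\<exists>V. subspace V \<and> min_attainment_set S = {x \<in> V. norm x = 1})) \<and>
    (bounded_clinear T \<longrightarrow> min_attainment_set T \<noteq> {} \<longrightarrow>
      (\<exists>V. csubspace V \<and> min_attainment_set T = {x \<in> V. norm x = 1}))"
proof (intro conjI impI)
  assume "bounded_linear S" "min_attainment_set S \<noteq> {}"
  then have "subspace (min_scaling_set S)"
    by (intro subspace_min_scaling_set min_modulus_nonneg bounded_linear.linear)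
  then show "\<exists>V. subspace V \<and> min_attainment_set S = {x \<in> V. norm x = 1}"
    using min_attainment_set_eq_sphere by blast
next
  assume "bounded_clinear T" "min_attainment_set T \<noteq> {}"
  \<comment> \<open>As in the real case, \<open>min_scaling_set\<close> of the operator is the
    witness for \<open>V\<close>.\<close>
  then have "csubspace (min_scaling_set T)"
    by (intro csubspace_min_scaling_set min_modulus_nonneg) (auto simp: bounded_clinear_def)
  then show "\<exists>V. csubspace V \<and> min_attainment_set T = {x \<in> V. norm x = 1}"
    using min_attainment_set_eq_sphere by blast
qed

end
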